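(* Let $\alpha\in[1,\infty)$ and suppose that Assumptions 1 and 2 (stated in the context) hold for $X$, the group structure, the weights and $\alpha$. Then for any $\lambda>0$ and $y\in\mathbb{R}^n$, the solution $\hat\beta$ to the block Lasso problem $$\min_{\beta\in\mathbb{R}^p}\Big\{\frac1{2n}\|y-X\beta\|^2+\lambda\sum_{j=1}^J w_j\|\beta_{(j)}\|_\alpha\Big\}$$ is unique, and $|\{j:\hat\beta_{(j)}\neq0\}|\le\min(n,J)$.
   Context: $X\in\mathbb{R}^{n\times p}$; $\{1,\dots,p\}$ is partitioned into nonempty groups $\mathcal{G}_1,\dots,\mathcal{G}_J$, $p_j=|\mathcal{G}_j|$. For $v\in\mathbb{R}^p$, $v_{(j)}=(v_k)_{k\in\mathcal{G}_j}$; for a matrix $M$ with $p$ columns, $M_{(j)}$ is the submatrix of the columns in $\mathcal{G}_j$. Weights $w_j>0$; $W$ is the $p\times p$ diagonal matrix with entry $w_j$ at indices in $\mathcal{G}_j$. $\|\cdot\|$ is the Euclidean norm. $\alpha^*$ satisfies $1/\alpha+1/\alpha^*=1$. For $\alpha\in(1,\infty)$, $\rho=\alpha^*/\alpha$ and $\eta(x)=\mathrm{sgn}(x)|x|^\rho$ for $x\in[-1,1]$, applied componentwise to vectors. The case $\alpha=1$ is the Lasso, for which all groups are taken to be singletons ($p_j=1$, $J=p$), $\alpha^*=\infty$, and $\eta(x)=x\,I(|x|=1)$. Assumption 1: every $\min(n,p)$ columns of $X$ are linearly independent. Assumption 2: (a) $p_j\le n$ for all $j$; (b) the columns of $M=XW^{-1}$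 are in blockwise general position: for every $s\in\mathrm{row}(M)$ (row space), the family of vectors $M_{(j)}\eta(s_{(j)})$, $j\in\mathcal E=\{j:\|s_{(j)}\|_{\alpha^*}=1\}$, is in general position, i.e. for every $k<n$ no $k$-dimensional affine subspace of $\mathbb{R}^n$ contains more than $k+1$ members of the family. *)

theory Defs
  imports "HOL-Analysis.Analysis"
begin

definition conj_exponent :: "real \<Rightarrow> ereal" where
  "conj_exponent \<alpha> = (if \<alpha> = 1 then \<infinity> else ereal (\<alpha> / (\<alpha> - 1)))"

text \<open>The closed form is the exponent given by the usual duality equation. The condition
  \<open>0 < q\<close> only discards the spurious solution \<open>q = -\<infinity>\<close> for \<open>\<alpha> = 1\<close> in the type \<^typ>\<open>ereal\<close>.\<close>

lemma conj_exponent_iff: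
  assumes "1 \<le> \<alpha>" and "0 < q"
  shows "1 / ereal \<alpha> + 1 / q = 1 \<longleftrightarrow> q = conj_exponent \<alpha>"
proof (cases q)
  case (real r)
  with assms show ?thesis
    by (auto simp: conj_exponent_def one_ereal_def field_simps)
next
  case PInf
  with assms show ?thesis
    by (auto simp: conj_exponent_def one_ereal_def field_simps)
next
  case MInf
  with assms show ?thesis by simp
qed

definition lp_norm :: "ereal \<Rightarrow> real^'p \<Rightarrow> real" where
  "lp_norm q v =
     (if q = \<infinity> then infnorm v
      else (\<Sum>k\<in>UNIV. \<bar>v $ k\<bar> powr real_of_ereal q) powr (1 / real_of_ereal q))"

text \<open>Only used at arguments in \<open>[-1,1]\<close>.\<close>

definition eta :: "real \<Rightarrow> real \<Rightarrow> real" where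
  "eta \<alpha> x =
     (if \<alpha> = 1 then (if \<bar>x\<bar> = 1 then x else 0)
      else sgn x * \<bar>x\<bar> powr (real_of_ereal (conj_exponent \<alpha>) / \<alpha>))"

definition eta_vec :: "real \<Rightarrow> real^'p \<Rightarrow> real^'p" where
  "eta_vec \<alpha> v = (\<chi> k. eta \<alpha> (v $ k))"

text \<open>The index type \<open>'j\<close> of the groups plays the role of \<open>{1..J}\<close>.\<close>

definition group_partition :: "('j \<Rightarrow> 'p set) \<Rightarrow> bool" where
  "group_partition G \<longleftrightarrow>
     (\<forall>j. G j \<noteq> {}) \<and> disjoint_family G \<and> (\<Union>j. G j) = UNIV"

text \<open>The subvector \<open>v\<^sub>(\<^sub>j\<^sub>)\<close> is encoded by its extension by zero, \<open>block (G j) v\<close>. Its \<open>lp_norm\<close>s are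
  those of the subvector, it vanishes iff the subvector does, and since \<open>eta \<alpha> 0 = 0\<close> the product
  of the column submatrix \<open>M\<^sub>(\<^sub>j\<^sub>)\<close> with \<open>\<eta>(s\<^sub>(\<^sub>j\<^sub>))\<close> is \<open>M *v eta_vec \<alpha> (block (G j) s)\<close>.\<close>

definition block :: "'p set \<Rightarrow> real^'p \<Rightarrow> real^'p" where
  "block S v = (\<chi> k. if k \<in> S then v $ k else 0)"

lemma mult_eta_vec_block:
  "M *v eta_vec \<alpha> (block S s) = (\<Sum>k\<in>S. eta \<alpha> (s $ k) *s column k M)"
proof -
  have "M *v eta_vec \<alpha> (block S s)
      = (\<Sum>k\<in>UNIV. (if k \<in> S then eta \<alpha> (s $ k) *s column k M else 0))"
    unfolding matrix_mult_sum
    by (rule sum.cong) (auto simp: eta_vec_def block_def eta_def)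
  then show ?thesis
    by (simp add: sum.If_cases)
qed

definition weight_matrix :: "('j \<Rightarrow> 'p set) \<Rightarrow> ('j \<Rightarrow> real) \<Rightarrow> real^'p^'p" where
  "weight_matrix G w = (\<chi> k l. if k = l then w (THE j. k \<in> G j) else 0)"

text \<open>Linear independence of columns is meant for the indexed family, so equal columns with
  different indices are dependent.\<close>

definition columns_independent :: "real^'p^'n \<Rightarrow> 'p set \<Rightarrow> bool" where
  "columns_independent X S \<longleftrightarrow>
     inj_on (\<lambda>k. column k X) S \<and> independent ((\<lambda>k. column k X) ` S)"

definition assumption1 :: "real^'p^'n \<Rightarrow> bool" where
  "assumption1 X \<longleftrightarrow>
     (\<forall>S. card S = min CARD('n) CARD('p) \<longrightarrow> columns_independent X S)"

text \<open>Members of a family are counted by index, i.e. with multiplicity.\<close>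

definition general_position :: "'j::finite set \<Rightarrow> ('j \<Rightarrow> real^'n) \<Rightarrow> bool" where
  "general_position E f \<longleftrightarrow>
     (\<forall>k < CARD('n). \<forall>A. affine A \<and> aff_dim A = int k \<longrightarrow> card {j \<in> E. f j \<in> A} \<le> k + 1)"

definition row_space :: "real^'p^'n \<Rightarrow> (real^'p) set" where
  "row_space M = span (rows M)"

definition blockwise_general_position ::
    "real \<Rightarrow> ('j::finite \<Rightarrow> 'p set) \<Rightarrow> real^'p^'n \<Rightarrow> bool" where
  "blockwise_general_position \<alpha> G M \<longleftrightarrow>
     (\<forall>s \<in> row_space M.
        general_position {j. lp_norm (conj_exponent \<alpha>) (block (G j) s) = 1}
          (\<lambda>j. M *v eta_vec \<alpha> (block (G j) s)))"

definition assumption2 ::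
    "real \<Rightarrow> ('j::finite \<Rightarrow> 'p set) \<Rightarrow> ('j \<Rightarrow> real) \<Rightarrow> real^'p^'n \<Rightarrow> bool" where
  "assumption2 \<alpha> G w X \<longleftrightarrow>
     (\<forall>j. card (G j) \<le> CARD('n)) \<and>
     blockwise_general_position \<alpha> G (X ** matrix_inv (weight_matrix G w))"

definition block_lasso_objective ::
    "real \<Rightarrow> ('j::finite \<Rightarrow> 'p set) \<Rightarrow> ('j \<Rightarrow> real) \<Rightarrow> real^'p^'n \<Rightarrow> real^'n \<Rightarrow> real \<Rightarrow>
     real^'p \<Rightarrow> real" where
  "block_lasso_objective \<alpha> G w X y lam \<beta> =
     1 / (2 * real CARD('n)) * (norm (y - X *v \<beta>))\<^sup>2
     + lam * (\<Sum>j\<in>UNIV. w j * lp_norm (ereal \<alpha>) (block (G j) \<beta>))"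

definition block_lasso_solution ::
    "real \<Rightarrow> ('j::finite \<Rightarrow> 'p set) \<Rightarrow> ('j \<Rightarrow> real) \<Rightarrow> real^'p^'n \<Rightarrow> real^'n \<Rightarrow> real \<Rightarrow>
     real^'p \<Rightarrow> bool" where
  "block_lasso_solution \<alpha> G w X y lam \<beta> \<longleftrightarrow>
     is_arg_min (block_lasso_objective \<alpha> G w X y lam) (\<lambda>_. True) \<beta>"

end

theory Submission
  imports Defs
begin

text \<open>Stationarity at a solution \<open>\<beta>\<close> gives \<open>s = M\<^sup>T u\<close> in the row space of \<open>M\<close>, with
  \<open>u = (y - X \<beta>) / (n \<lambda>)\<close>, such that every nonzero block is a multiple
  \<open>\<beta>\<^sub>(\<^sub>j\<^sub>) = \<parallel>\<beta>\<^sub>(\<^sub>j\<^sub>)\<parallel>\<^sub>\<alpha> \<eta>(s\<^sub>(\<^sub>j\<^sub>))\<close> with \<open>\<parallel>s\<^sub>(\<^sub>j\<^sub>)\<parallel>\<^bsub>\<alpha>*\<^esub> = 1\<close> (the equality case of Young's inequality).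
  The vectors \<open>f\<^sub>j = M\<^sub>(\<^sub>j\<^sub>) \<eta>(s\<^sub>(\<^sub>j\<^sub>))\<close>, \<open>j \<in> \<E>\<close>, all lie on the hyperplane \<open>u \<bullet> x = 1\<close>, which misses the origin, so
  in general position there are at most \<open>n\<close> of them and they are linearly independent. The fit
  \<open>X \<beta>\<close> is the same for all solutions by strict convexity of the loss; hence so are \<open>s\<close> and the
  coefficients of \<open>X \<beta> = \<Sum>\<^sub>j w\<^sub>j \<parallel>\<beta>\<^sub>(\<^sub>j\<^sub>)\<parallel>\<^sub>\<alpha> f\<^sub>j\<close>, and therefore \<open>\<beta>\<close>.\<close>

section \<open>Convexity and Young's inequality\<close>

text \<open>For positive arguments this is convexity of the power. If one argument is 0, a single
  term remains and the claim reduces to \<open>t powr p \<le> t\<close> for t in [0,1].\<close>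

lemma powr_convex_nonneg:
  fixes x y :: real
  assumes "1 \<le> p" "0 \<le> x" "0 \<le> y" "0 \<le> u" "0 \<le> v" "u + v = 1"
  shows "(u * x + v * y) powr p \<le> u * x powr p + v * y powr p"
proof -
  have contract: "(t * z) powr p \<le> t * z powr p" if "0 \<le> t" "t \<le> 1" "0 \<le> z" for t z :: real
  proof (cases "t = 0")
    case False
    then have "t powr p \<le> t"
      using powr_mono'[of 1 p t] that assms(1) by simp
    then show ?thesis
      using that by (simp add: powr_mult mult_right_mono)
  qed simp
  consider "x = 0" | "y = 0" | "0 < x" "0 < y"
    using assms by linarith
  then show ?thesis
  proof cases
    case 3
    have u: "u = 1 - v" using assms by simp
    show ?thesis
      using convex_onD[OF powr_convex[OF assms(1)], of v x y] 3 assms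
      unfolding u by simp
  qed (use contract[of v y] contract[of u x] assms in auto)
qed

text \<open>Normalise by the geometric mean g and add the bounds \<open>ln z \<le> z - 1\<close> at
  z = x/g and z = y/g with weights u, v. Both sides add up to 0, so each bound is an equality, which
  happens only at z = 1.\<close>

lemma weighted_am_gm_eq:
  fixes x y :: real
  assumes "0 < x" "0 < y" "0 < u" "0 < v" "u + v = 1"
    and eq: "u * x + v * y = x powr u * y powr v"
  shows "x = y"
proof -
  define g where "g = x powr u * y powr v"
  have g: "0 < g" using assms by (simp add: g_def)
  have lg: "ln g = u * ln x + v * ln y"
    using assms by (simp add: g_def ln_mult ln_powr)
  have bx: "ln (x / g) \<le> x / g - 1" and "ln (y / g) \<le> y / g - 1"
    using g assms by (auto intro!: ln_le_minus_one)
  then have by1: "v * ln (y / g) \<le> v * (y / g - 1)" and bx1: "u * ln (x / g) \<le> u * (x / g - 1)"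
    using assms by (auto intro: mult_left_mono)
  have "u * ln (x / g) + v * ln (y / g) = u * ln x + v * ln y - (u + v) * ln g"
    using g assms(1,2) by (simp add: ln_div algebra_simps)
  also have "\<dots> = 0"
    using assms(5) lg by simp
  finally have s0: "u * ln (x / g) + v * ln (y / g) = 0" .
  have "u * (x / g - 1) + v * (y / g - 1) = (u * x + v * y) / g - (u + v)"
    by (simp add: algebra_simps add_divide_distrib)
  then have s1: "u * (x / g - 1) + v * (y / g - 1) = 0"
    using eq[folded g_def] g assms(5) by simp
  have "u * ln (x / g) = u * (x / g - 1)" "v * ln (y / g) = v * (y / g - 1)"
    using s0 s1 bx1 by1 by linarith+
  then have "ln (x / g) = x / g - 1" "ln (y / g) = y / g - 1"
    using assms by auto
  then have "x / g = 1" "y / g = 1"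
    using g assms(1,2) by (meson divide_pos_pos ln_eq_minus_one)+
  then show ?thesis using g by simp
qed

lemma eta_eq_powr:
  assumes "1 < \<alpha>"
  shows "eta \<alpha> x = sgn x * \<bar>x\<bar> powr (1 / (\<alpha> - 1))"
  using assms by (simp add: eta_def conj_exponent_def)

text \<open>The exponent in \<open>eta\<close> is 1/(\<alpha> - 1) = q/\<alpha> = q - 1. Thus
  \<open>eta\<close> is the derivative of |x|^q / q and inverts that of |y|^\<alpha> /
  \<alpha>.\<close>

lemma
  fixes \<alpha> :: real and x :: real
  assumes "1 < \<alpha>"
  defines "q \<equiv> \<alpha> / (\<alpha> - 1)"
  shows abs_eta_powr: "\<bar>eta \<alpha> x\<bar> powr \<alpha> = \<bar>x\<bar> powr q"
    and mult_eta: "x * eta \<alpha> x = \<bar>x\<bar> powr q"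
proof -
  have q: "q = 1 + 1 / (\<alpha> - 1)" "(1 / (\<alpha> - 1)) * \<alpha> = q"
    using assms by (auto simp: field_simps)
  show "\<bar>eta \<alpha> x\<bar> powr \<alpha> = \<bar>x\<bar> powr q"
    using assms(1) q by (cases "x = 0") (auto simp: eta_eq_powr abs_mult powr_powr)
  have "x * eta \<alpha> x = \<bar>x\<bar> * \<bar>x\<bar> powr (1 / (\<alpha> - 1))"
    using assms(1) by (simp add: eta_eq_powr abs_sgn)
  also have "\<dots> = \<bar>x\<bar> powr q"
    by (simp add: q(1) powr_mult_base)
  finally show "x * eta \<alpha> x = \<bar>x\<bar> powr q" .
qed

text \<open>Young's inequality for the absolute values is weighted AM-GM for |x|^q and |y|^\<alpha>
  with weights 1/q and 1/\<alpha>. Equality forces these powers to agree, and x, y to have the same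
  sign.\<close>

lemma young_eta:
  fixes x y :: real
  assumes \<alpha>: "1 < \<alpha>" and q: "q = \<alpha> / (\<alpha> - 1)"
  shows "x * y \<le> \<bar>x\<bar> powr q / q + \<bar>y\<bar> powr \<alpha> / \<alpha>"
    and "x * y = \<bar>x\<bar> powr q / q + \<bar>y\<bar> powr \<alpha> / \<alpha> \<Longrightarrow> y = eta \<alpha> x"
proof -
  have q1: "1 < q" "1 / q + 1 / \<alpha> = 1"
    using \<alpha> by (auto simp: q field_simps)
  have Y: "\<bar>x\<bar> * \<bar>y\<bar> \<le> \<bar>x\<bar> powr q / q + \<bar>y\<bar> powr \<alpha> / \<alpha>"
    using Youngs_inequality[of q \<alpha> "\<bar>x\<bar>" "\<bar>y\<bar>"] \<alpha> q1 by simp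
  have xy: "x * y \<le> \<bar>x\<bar> * \<bar>y\<bar>"
    by (metis abs_ge_self abs_mult)
  show "x * y \<le> \<bar>x\<bar> powr q / q + \<bar>y\<bar> powr \<alpha> / \<alpha>"
    using Y xy by linarith
  assume eq: "x * y = \<bar>x\<bar> powr q / q + \<bar>y\<bar> powr \<alpha> / \<alpha>"
  have abs_eq: "x * y = \<bar>x\<bar> * \<bar>y\<bar>"
    using Y xy eq by linarith
  show "y = eta \<alpha> x"
  \<comment> \<open>The equality case of AM-GM needs positive arguments; with a zero factor, both
    nonnegative terms on the right must vanish.\<close>
  proof (cases "x = 0 \<or> y = 0")
    case True
    then have "\<bar>x\<bar> powr q / q + \<bar>y\<bar> powr \<alpha> / \<alpha> = 0"
      using eq by auto
    moreover have "0 \<le> \<bar>x\<bar> powr q / q" "0 \<le> \<bar>y\<bar> powr \<alpha> / \<alpha>"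
      using q1 \<alpha> by auto
    ultimately have "\<bar>x\<bar> powr q / q = 0" "\<bar>y\<bar> powr \<alpha> / \<alpha> = 0"
      by linarith+
    then have "x = 0" "y = 0"
      using q1 \<alpha> by auto
    then show ?thesis by (simp add: eta_def)
  next
    case False
    have "1 / q * \<bar>x\<bar> powr q + 1 / \<alpha> * \<bar>y\<bar> powr \<alpha> = (\<bar>x\<bar> powr q) powr (1/q) * (\<bar>y\<bar> powr \<alpha>) powr (1/\<alpha>)"
    proof -
      have "(\<bar>x\<bar> powr q) powr (1/q) = \<bar>x\<bar>" "(\<bar>y\<bar> powr \<alpha>) powr (1/\<alpha>) = \<bar>y\<bar>"
        using q1(1) \<alpha> by (simp_all add: powr_powr)
      then show ?thesis using eq abs_eq by simp
    qed
    then have "\<bar>x\<bar> powr q = \<bar>y\<bar> powr \<alpha>"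
      by (rule weighted_am_gm_eq[rotated 5]) (use False q1 \<alpha> in simp_all)
    then have "(\<bar>y\<bar> powr \<alpha>) powr (1/\<alpha>) = (\<bar>eta \<alpha> x\<bar> powr \<alpha>) powr (1/\<alpha>)"
      using abs_eta_powr[OF \<alpha>, of x] q by simp
    then have ab: "\<bar>y\<bar> = \<bar>eta \<alpha> x\<bar>"
      using \<alpha> by (simp add: powr_powr)
    have "0 < x * y"
      using False abs_eq by simp
    then have "sgn y = sgn x"
      by (auto simp: zero_less_mult_iff)
    moreover have "sgn (eta \<alpha> x) = sgn x"
      using False \<alpha> by (simp add: eta_eq_powr sgn_mult)
    ultimately show ?thesis
      using ab by (metis mult_sgn_abs)
  qed
qed

section \<open>The norms and their dual pairs\<close>

lemma lp_norm_real: "lp_norm (ereal p) v = (\<Sum>k\<in>UNIV. \<bar>v $ k\<bar> powr p) powr (1 / p)"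
  by (simp add: lp_norm_def)

lemma lp_norm_nonneg: "0 \<le> lp_norm (ereal p) v"
  by (simp add: lp_norm_real)

lemma lp_norm_powr: "0 < p \<Longrightarrow> lp_norm (ereal p) v powr p = (\<Sum>k\<in>UNIV. \<bar>v $ k\<bar> powr p)"
  by (simp add: lp_norm_real powr_powr sum_nonneg)

lemma lp_norm_le_iff:
  assumes "0 < p" "0 \<le> c"
  shows "lp_norm (ereal p) v \<le> c \<longleftrightarrow> (\<Sum>k\<in>UNIV. \<bar>v $ k\<bar> powr p) \<le> c powr p"
  using assms lp_norm_nonneg[of p v] powr_mono2[of p "lp_norm (ereal p) v" c]
    powr_less_mono2[of p c "lp_norm (ereal p) v"]
  by (auto simp: lp_norm_powr not_le[symmetric])

lemma lp_norm_scaleR: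
  assumes "0 < p"
  shows "lp_norm (ereal p) (c *\<^sub>R v) = \<bar>c\<bar> * lp_norm (ereal p) v"
  using assms
  by (simp add: lp_norm_real abs_mult powr_mult sum_distrib_left[symmetric] powr_powr sum_nonneg)

lemma component_le_lp_norm:
  assumes "0 < p"
  shows "\<bar>v $ k\<bar> \<le> lp_norm (ereal p) v"
proof (rule ccontr)
  assume "\<not> ?thesis"
  then have "lp_norm (ereal p) v powr p < \<bar>v $ k\<bar> powr p"
    using assms lp_norm_nonneg[of p v] by (intro powr_less_mono2) auto
  moreover have "\<bar>v $ k\<bar> powr p \<le> (\<Sum>k\<in>UNIV. \<bar>v $ k\<bar> powr p)"
    by (intro member_le_sum) auto
  ultimately show False using assms by (simp add: lp_norm_powr)
qed

lemma lp_norm_eq_0_iff: "0 < p \<Longrightarrow> lp_norm (ereal p) v = 0 \<longleftrightarrow> v = 0"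
  using component_le_lp_norm[of p v] by (auto simp: vec_eq_iff lp_norm_real)

text \<open>Minkowski's inequality from convexity of the power: with both vectors scaled to norm 1,
  the entries of the sum become convex combinations with weights a/(a+b) and b/(a+b).\<close>

lemma lp_norm_triangle:
  fixes x y :: "real^'p"
  assumes p: "1 \<le> p"
  shows "lp_norm (ereal p) (x + y) \<le> lp_norm (ereal p) x + lp_norm (ereal p) y"
proof -
  define a b where "a = lp_norm (ereal p) x" and "b = lp_norm (ereal p) y"
  have p0: "0 < p" using p by simp
  have nn: "0 \<le> a" "0 \<le> b" by (auto simp: a_def b_def lp_norm_nonneg)
  show ?thesis
  proof (cases "a = 0 \<or> b = 0")
    case True
    then have "x = 0 \<or> y = 0"
      using p0 by (auto simp: a_def b_def lp_norm_eq_0_iff)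
    then show ?thesis by (auto simp: lp_norm_nonneg)
  next
    case False
    define u v where "u = a / (a + b)" and "v = b / (a + b)"
    have pos: "0 < a" "0 < b" using nn False by auto
    have uv: "0 \<le> u" "0 \<le> v" "u + v = 1"
      using pos by (auto simp: u_def v_def add_divide_distrib[symmetric])
    have split: "(\<bar>x $ k\<bar> + \<bar>y $ k\<bar>) = (a + b) * (u * (\<bar>x $ k\<bar> / a) + v * (\<bar>y $ k\<bar> / b))" for k
    proof -
      have "(a + b) * u = a" "(a + b) * v = b"
        using pos by (auto simp: u_def v_def)
      then have "(a + b) * (u * (\<bar>x $ k\<bar> / a) + v * (\<bar>y $ k\<bar> / b)) = a * (\<bar>x $ k\<bar> / a) + b * (\<bar>y $ k\<bar> / b)"
        by (metis distrib_left mult.assoc)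
      then show ?thesis
        using pos by simp
    qed
    have "\<bar>(x + y) $ k\<bar> powr p \<le> (a + b) powr p * (u * (\<bar>x $ k\<bar> / a) powr p + v * (\<bar>y $ k\<bar> / b) powr p)" for k
    proof -
      have "\<bar>(x + y) $ k\<bar> powr p \<le> (\<bar>x $ k\<bar> + \<bar>y $ k\<bar>) powr p"
        using p by (intro powr_mono2) auto
      also have "\<dots> = (a + b) powr p * (u * (\<bar>x $ k\<bar> / a) + v * (\<bar>y $ k\<bar> / b)) powr p"
        using uv pos by (simp only: split powr_mult)
      also have "\<dots> \<le> (a + b) powr p * (u * (\<bar>x $ k\<bar> / a) powr p + v * (\<bar>y $ k\<bar> / b) powr p)"
        using uv pos p by (intro mult_left_mono powr_convex_nonneg) auto
      finally show ?thesis .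
    qed
    then have "(\<Sum>k\<in>UNIV. \<bar>(x + y) $ k\<bar> powr p)
        \<le> (\<Sum>k\<in>UNIV. (a + b) powr p * (u * (\<bar>x $ k\<bar> / a) powr p + v * (\<bar>y $ k\<bar> / b) powr p))"
      by (rule sum_mono)
    also have "\<dots> = (a + b) powr p *
        (u * ((\<Sum>k\<in>UNIV. \<bar>x $ k\<bar> powr p) / a powr p) + v * ((\<Sum>k\<in>UNIV. \<bar>y $ k\<bar> powr p) / b powr p))"
      using pos by (simp add: powr_divide sum_distrib_left sum_divide_distrib sum.distrib distrib_left)
    \<comment> \<open>Both normalised power sums equal 1, so the bracket is u + v = 1.\<close>
    also have "\<dots> = (a + b) powr p"
      using pos uv p0 by (simp add: lp_norm_powr[OF p0, symmetric] a_def[symmetric] b_def[symmetric])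
    finally show ?thesis
      using pos p0 by (simp add: lp_norm_le_iff a_def b_def lp_norm_nonneg)
  qed
qed

lemma lp_norm_block_le:
  assumes "0 < p"
  shows "lp_norm (ereal p) (block S v) \<le> lp_norm (ereal p) v"
  unfolding lp_norm_real using assms
  by (intro powr_mono2 sum_mono sum_nonneg) (auto simp: block_def)

lemma block_scaleR: "block S (c *\<^sub>R v) = c *\<^sub>R block S v"
  by (simp add: block_def vec_eq_iff)

lemma block_add: "block S (v + v') = block S v + block S v'"
  by (simp add: block_def vec_eq_iff)

lemma inner_block: "block S v \<bullet> x = v \<bullet> block S x"
  unfolding inner_vec_def by (rule sum.cong) (auto simp: block_def)

text \<open>The terms v_k \<eta>(v_k) are |v_k|^q, so the inner product is the q-th power of the
  dual norm.\<close>

lemma inner_eta_vec_of_dual_unit: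
  fixes v :: "real^'p"
  assumes "1 < \<alpha>" "lp_norm (conj_exponent \<alpha>) v = 1"
  shows "v \<bullet> eta_vec \<alpha> v = 1"
proof -
  define q where "q = \<alpha> / (\<alpha> - 1)"
  have q: "0 < q" using assms by (simp add: q_def)
  have "v \<bullet> eta_vec \<alpha> v = (\<Sum>k\<in>UNIV. \<bar>v $ k\<bar> powr q)"
    using assms by (simp add: inner_vec_def eta_vec_def mult_eta q_def)
  also have "\<dots> = lp_norm (ereal q) v powr q"
    by (simp add: lp_norm_powr[OF q])
  finally show ?thesis
    using assms by (simp add: conj_exponent_def q_def)
qed

text \<open>The equality case of Hoelder's inequality. The bound \<open>dual\<close> gives dual norm
  at most 1; then Young's inequality, summed over the coordinates of v and the normalised b, is
  squeezed to an equality in every coordinate.\<close>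

lemma dual_pair_eta:
  fixes v b :: "real^'p"
  assumes \<alpha>: "1 < \<alpha>"
    and dual: "\<And>x. v \<bullet> x \<le> lp_norm (ereal \<alpha>) x"
    and eq: "v \<bullet> b = lp_norm (ereal \<alpha>) b" and "b \<noteq> 0"
  shows "lp_norm (conj_exponent \<alpha>) v = 1" "b = lp_norm (ereal \<alpha>) b *\<^sub>R eta_vec \<alpha> v"
proof -
  define q where "q = \<alpha> / (\<alpha> - 1)"
  define A where "A = (\<Sum>k\<in>UNIV. \<bar>v $ k\<bar> powr q)"
  define c where "c = inverse (lp_norm (ereal \<alpha>) b) *\<^sub>R b"
  have q: "0 < q" "1 / q + 1 / \<alpha> = 1" using \<alpha> by (auto simp: q_def field_simps)
  have \<alpha>0: "0 < \<alpha>" using \<alpha> by simp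
  have b0: "lp_norm (ereal \<alpha>) b \<noteq> 0" using \<open>b \<noteq> 0\<close> \<alpha>0 by (simp add: lp_norm_eq_0_iff)
  have A0: "0 \<le> A" by (simp add: A_def sum_nonneg)
  \<comment> \<open>The test vector \<eta>(v) turns \<open>dual\<close> into an inequality for A
    alone; since 1/\<alpha> < 1, it fails for A > 1.\<close>
  have "A = v \<bullet> eta_vec \<alpha> v"
    using \<alpha> by (simp add: A_def inner_vec_def eta_vec_def mult_eta q_def)
  also have "\<dots> \<le> A powr (1 / \<alpha>)"
    using dual[of "eta_vec \<alpha> v"] \<alpha> by (simp add: lp_norm_real eta_vec_def abs_eta_powr A_def q_def)
  finally have "A \<le> A powr (1 / \<alpha>)" .
  have A1: "A \<le> 1"
  proof (rule ccontr)
    assume "\<not> A \<le> 1"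
    then have "A powr (1 / \<alpha>) < A powr 1"
      using \<alpha> by (intro powr_less_mono) auto
    with \<open>A \<le> A powr (1 / \<alpha>)\<close> A0 show False by simp
  qed
  have cn: "lp_norm (ereal \<alpha>) c = 1"
    using b0 \<alpha>0 lp_norm_nonneg[of \<alpha> b] by (simp add: c_def lp_norm_scaleR)
  then have c1: "(\<Sum>k\<in>UNIV. \<bar>c $ k\<bar> powr \<alpha>) = 1"
    using lp_norm_powr[OF \<alpha>0, of c] by simp
  have vc: "v \<bullet> c = 1" using eq b0 by (simp add: c_def)
  have sum_rhs: "(\<Sum>k\<in>UNIV. \<bar>v $ k\<bar> powr q / q + \<bar>c $ k\<bar> powr \<alpha> / \<alpha>) = A / q + 1 / \<alpha>"
    by (simp add: sum.distrib sum_divide_distrib[symmetric] A_def c1)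
  have le: "v $ k * c $ k \<le> \<bar>v $ k\<bar> powr q / q + \<bar>c $ k\<bar> powr \<alpha> / \<alpha>" for k
    using young_eta(1)[OF \<alpha>] q_def by blast
  have "v \<bullet> c \<le> A / q + 1 / \<alpha>"
    unfolding sum_rhs[symmetric] inner_vec_def by (auto intro: sum_mono le)
  moreover have "A / q \<le> 1 / q" using A1 q by (simp add: divide_right_mono)
  \<comment> \<open>The chain is 1 = v \<bullet> c \<le> A/q + 1/\<alpha> \<le> 1/q + 1/\<alpha> =
    1.\<close>
  ultimately have "A / q = 1 / q" "v \<bullet> c = A / q + 1 / \<alpha>" using vc q by linarith+
  then have "A = 1" using q by simp
  then show "lp_norm (conj_exponent \<alpha>) v = 1"
    using \<alpha> by (simp add: conj_exponent_def lp_norm_real A_def q_def)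
  have "v $ k * c $ k = \<bar>v $ k\<bar> powr q / q + \<bar>c $ k\<bar> powr \<alpha> / \<alpha>" for k
  proof (rule ccontr)
    assume "\<not> ?thesis"
    then have "v $ k * c $ k < \<bar>v $ k\<bar> powr q / q + \<bar>c $ k\<bar> powr \<alpha> / \<alpha>"
      using le[of k] by simp
    then have "v \<bullet> c < A / q + 1 / \<alpha>"
      unfolding sum_rhs[symmetric] inner_vec_def using le by (auto intro!: sum_strict_mono_ex1)
    with \<open>v \<bullet> c = A / q + 1 / \<alpha>\<close> show False by simp
  qed
  then have "c $ k = eta \<alpha> (v $ k)" for k
    using young_eta(2)[OF \<alpha> q_def] by blast
  then have "c = eta_vec \<alpha> v" by (simp add: vec_eq_iff eta_vec_def)
  then show "b = lp_norm (ereal \<alpha>) b *\<^sub>R eta_vec \<alpha> v"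
    using b0 by (simp add: c_def flip: \<open>c = eta_vec \<alpha> v\<close>)
qed

section \<open>Singleton groups, and duality on one block for all \<alpha>\<close>

lemma infnorm_scaled_axis: "infnorm (c *\<^sub>R axis k (1::real)) = \<bar>c\<bar>"
proof -
  have "infnorm (axis k (1::real)) = 1"
    using infnorm_le_norm[of "axis k (1::real)"] component_le_infnorm_cart[of "axis k (1::real)" k]
    by (simp add: norm_axis_1)
  then show ?thesis by (simp add: infnorm_mul)
qed

lemma block_singleton: "block {k} v = (v $ k) *\<^sub>R axis k 1"
  by (simp add: block_def axis_def vec_eq_iff)

lemma lp_norm_one_scaled_axis: "lp_norm (ereal 1) (c *\<^sub>R axis k 1) = \<bar>c\<bar>"
proof -
  have "(\<Sum>l\<in>UNIV. \<bar>(c *\<^sub>R axis k 1) $ l\<bar>) = (\<Sum>l\<in>UNIV. if l = k then \<bar>c\<bar> else 0)"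
    by (rule sum.cong) (auto simp: axis_def)
  then show ?thesis by (simp add: lp_norm_real)
qed

text \<open>For \<alpha> = 1 the only entry of the block is 1 or -1, so \<open>eta\<close> fixes it
  and the inner product is its square.\<close>

lemma inner_block_eta_vec:
  fixes s :: "real^'p"
  assumes "1 \<le> \<alpha>" "\<alpha> = 1 \<Longrightarrow> card S = 1" "lp_norm (conj_exponent \<alpha>) (block S s) = 1"
  shows "block S s \<bullet> eta_vec \<alpha> (block S s) = 1"
proof (cases "\<alpha> = 1")
  case True
  then obtain k where S: "S = {k}" using assms(2) by (meson card_1_singletonE)
  have sk: "\<bar>s $ k\<bar> = 1"
    using assms(3) True
    by (simp add: S conj_exponent_def lp_norm_def block_singleton infnorm_scaled_axis)
  then have "eta_vec \<alpha> (block S s) = block S s"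
    using True by (auto simp: S eta_vec_def eta_def block_def vec_eq_iff)
  moreover have "s $ k * s $ k = 1"
    using sk by (metis abs_mult_self_eq mult_1)
  ultimately show ?thesis
    by (simp add: S block_singleton inner_axis)
next
  case False
  then show ?thesis using assms by (intro inner_eta_vec_of_dual_unit) auto
qed

text \<open>For \<alpha> = 1 the equality reads s_k \<beta>_k = |\<beta>_k| with \<beta>_k nonzero,
  so s_k is the sign of \<beta>_k. For \<alpha> > 1 this is \<open>dual_pair_eta\<close>.\<close>

lemma dual_pair_block:
  fixes s \<beta> :: "real^'p"
  assumes "1 \<le> \<alpha>" "\<alpha> = 1 \<Longrightarrow> card S = 1"
    and dual: "\<And>x. block S s \<bullet> x \<le> lp_norm (ereal \<alpha>) x"
    and eq: "block S s \<bullet> block S \<beta> = lp_norm (ereal \<alpha>) (block S \<beta>)"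
    and nz: "block S \<beta> \<noteq> 0"
  shows "lp_norm (conj_exponent \<alpha>) (block S s) = 1 \<and>
    block S \<beta> = lp_norm (ereal \<alpha>) (block S \<beta>) *\<^sub>R eta_vec \<alpha> (block S s)"
proof (cases "\<alpha> = 1")
  case True
  then obtain k where S: "S = {k}" using assms(2) by (meson card_1_singletonE)
  have bk: "\<beta> $ k \<noteq> 0" using nz by (auto simp: S block_singleton)
  have prod: "s $ k * \<beta> $ k = \<bar>\<beta> $ k\<bar>"
    using eq True by (simp add: S block_singleton lp_norm_one_scaled_axis inner_axis mult.commute)
  then have sk: "s $ k = sgn (\<beta> $ k)"
    using bk by (simp add: abs_sgn mult.commute)
  then have "\<bar>s $ k\<bar> = 1" using bk by simp
  then have "eta_vec \<alpha> (block S s) = block S s"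
    using True by (auto simp: S eta_vec_def eta_def block_def vec_eq_iff)
  moreover have "lp_norm (conj_exponent \<alpha>) (block S s) = 1"
    using True \<open>\<bar>s $ k\<bar> = 1\<close>
    by (simp add: S conj_exponent_def lp_norm_def block_singleton infnorm_scaled_axis)
  moreover have "\<beta> $ k = \<bar>\<beta> $ k\<bar> * s $ k"
    using sk by (simp add: abs_mult_sgn)
  ultimately show ?thesis
    using True by (simp add: S block_singleton lp_norm_one_scaled_axis)
next
  case False
  then show ?thesis using assms dual_pair_eta[OF _ dual eq nz] by simp
qed

section \<open>General position on a hyperplane\<close>

text \<open>General position is applied to the affine hull of the family itself, whose dimension k
  is at most n - 1 because it lies in a hyperplane. This gives card E \<le> k + 1, while r points
  span dimension at most r - 1. Equality throughout excludes repetitions and affine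
  relations.\<close>

lemma general_position_hyperplane:
  fixes f :: "'j::finite \<Rightarrow> real^'n"
  assumes gp: "general_position E f" and hyp: "\<And>j. j \<in> E \<Longrightarrow> u \<bullet> f j = 1"
  shows "card E \<le> CARD('n)"
    and "inj_on f E" and "\<not> affine_dependent (f ` E)"
proof -
  have "card E \<le> CARD('n) \<and> inj_on f E \<and> \<not> affine_dependent (f ` E)"
  proof (cases "E = {}")
    case False
    define A where "A = affine hull (f ` E)"
    define k where "k = nat (aff_dim A)"
    \<comment> \<open>The empty set has \<open>aff_dim\<close> -1; for nonempty E the conversion by
      \<open>nat\<close> is exact.\<close>
    have "aff_dim A \<noteq> -1"
      using False by (simp add: A_def aff_dim_empty[symmetric])
    then have k: "aff_dim A = int k"
      using aff_dim_geq[of A] by (simp add: k_def)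
    have "u \<noteq> 0" using False hyp by force
    have "f ` E \<subseteq> {x. u \<bullet> x = 1}" using hyp by auto
    then have "A \<subseteq> {x. u \<bullet> x = 1}"
      unfolding A_def by (intro hull_minimal affine_hyperplane)
    then have "aff_dim A \<le> int CARD('n) - 1"
      using aff_dim_subset[of A "{x. u \<bullet> x = 1}"] aff_dim_hyperplane[OF \<open>u \<noteq> 0\<close>, of 1] by simp
    then have kn: "k < CARD('n)" using k by simp
    have "{j \<in> E. f j \<in> A} = E"
      unfolding A_def using hull_subset[of "f ` E" affine] by auto
    then have cE: "card E \<le> k + 1"
      using gp kn k unfolding general_position_def A_def by (metis affine_affine_hull)
    have "int k \<le> int (card (f ` E)) - 1"
      using aff_dim_le_card[of "f ` E"] k by (simp add: A_def)
    then have eq: "card (f ` E) = card E" "card (f ` E) = k + 1"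
      using cE card_image_le[of E f] by simp_all
    then have "inj_on f E" by (simp add: eq_card_imp_inj_on)
    moreover have "\<not> affine_dependent (f ` E)"
      using eq k by (simp add: affine_independent_iff_card A_def)
    ultimately show ?thesis using cE kn by simp
  qed simp
  then show "card E \<le> CARD('n)" "inj_on f E" "\<not> affine_dependent (f ` E)" by auto
qed

text \<open>Pairing a linear relation with u shows that its coefficients sum to 0. It is therefore
  an affine relation, and affine independence makes it trivial.\<close>

lemma general_position_hyperplane_unique_coeffs:
  fixes f :: "'j::finite \<Rightarrow> real^'n"
  assumes gp: "general_position E f" and hyp: "\<And>j. j \<in> E \<Longrightarrow> u \<bullet> f j = 1"
    and eq: "(\<Sum>j\<in>E. c j *\<^sub>R f j) = (\<Sum>j\<in>E. d j *\<^sub>R f j)" and "i \<in> E"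
  shows "c i = d i"
proof -
  note inj = general_position_hyperplane(2)[OF gp hyp]
  \<comment> \<open>Affine dependence concerns sets of points, so the coefficient differences are
    carried to the image by the inverse of f on E.\<close>
  define U where "U x = (let j = the_inv_into E f x in c j - d j)" for x
  have U: "U (f j) = c j - d j" if "j \<in> E" for j
    using that inj by (simp add: U_def the_inv_into_f_f)
  have s0: "(\<Sum>j\<in>E. (c j - d j) *\<^sub>R f j) = 0"
    using eq by (simp add: scaleR_left_diff_distrib sum_subtractf)
  have "(\<Sum>j\<in>E. c j - d j) = u \<bullet> (\<Sum>j\<in>E. (c j - d j) *\<^sub>R f j)"
    using hyp by (simp add: inner_sum_right)
  then have "sum U (f ` E) = 0"
    using U s0 inj by (simp add: sum.reindex)
  moreover have "(\<Sum>v\<in>f ` E. U v *\<^sub>R v) = 0"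
    using U s0 inj by (simp add: sum.reindex)
  ultimately have "\<forall>v\<in>f ` E. U v = 0"
    using general_position_hyperplane(3)[OF gp hyp] affine_dependent_explicit_finite[of "f ` E"]
    by auto
  then show ?thesis using U \<open>i \<in> E\<close> by force
qed

section \<open>Least squares with a sublinear penalty\<close>

text \<open>\<open>(y - X *v \<beta>) v* X\<close> is the transpose of X applied to the residual,
  that is, minus half the gradient of the squared loss.\<close>

lemma norm_diff_line:
  fixes X :: "real^'p^'n"
  shows "(norm (y - X *v (\<beta> + t *\<^sub>R d)))\<^sup>2 =
    (norm (y - X *v \<beta>))\<^sup>2 - 2 * t * (((y - X *v \<beta>) v* X) \<bullet> d) + t\<^sup>2 * (norm (X *v d))\<^sup>2"
proof -
  have "y - X *v (\<beta> + t *\<^sub>R d) = (y - X *v \<beta>) - t *\<^sub>R (X *v d)"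
    by (simp add: matrix_vector_right_distrib matrix_vector_mult_scaleR)
  then show ?thesis
    unfolding power2_norm_eq_inner dot_lmul_matrix
    by (simp add: inner_diff inner_commute power2_eq_square algebra_simps)
qed

lemma le_of_le_add_small:
  fixes a b K :: real
  assumes "\<And>t. 0 < t \<Longrightarrow> t < 1 \<Longrightarrow> a \<le> b + t * K"
  shows "a \<le> b"
proof (rule tendsto_lowerbound)
  show "((\<lambda>t. b + t * K) \<longlongrightarrow> b) (at_right 0)"
    by (rule tendsto_eq_intros refl | simp)+
  show "\<forall>\<^sub>F t in at_right 0. a \<le> b + t * K"
    unfolding eventually_at_right_field using assms by (intro exI[of _ 1]) auto
qed simp

text \<open>The subgradient condition for a sublinear penalty. A step t x raises N by at most t
  N(x); dividing by t and letting t tend to 0 removes the quadratic term. A step from \<beta>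
  towards 0 gives the reverse inequality at \<beta>.\<close>

lemma penalized_least_squares_optimality:
  fixes X :: "real^'p^'n"
  assumes tri: "\<And>x z. N (x + z) \<le> N x + N z"
    and hom: "\<And>t x. 0 \<le> t \<Longrightarrow> N (t *\<^sub>R x) = t * N x"
    and min: "\<And>z. c * (norm (y - X *v \<beta>))\<^sup>2 + N \<beta> \<le> c * (norm (y - X *v z))\<^sup>2 + N z"
  shows "2 * c * (((y - X *v \<beta>) v* X) \<bullet> x) \<le> N x"
    and "2 * c * (((y - X *v \<beta>) v* X) \<bullet> \<beta>) = N \<beta>"
proof -
  have dir: "2 * c * t * (((y - X *v \<beta>) v* X) \<bullet> d) \<le> N (\<beta> + t *\<^sub>R d) - N \<beta> + t * (t * (c * (norm (X *v d))\<^sup>2))" for t d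
    using min[of "\<beta> + t *\<^sub>R d"] unfolding norm_diff_line
    by (simp add: algebra_simps power2_eq_square)
  show le: "2 * c * (((y - X *v \<beta>) v* X) \<bullet> x) \<le> N x" for x
  proof (rule le_of_le_add_small)
    fix t :: real assume t: "0 < t" "t < 1"
    have "2 * c * t * (((y - X *v \<beta>) v* X) \<bullet> x) \<le> t * N x + t * (t * (c * (norm (X *v x))\<^sup>2))"
      using dir[of t x] tri[of \<beta> "t *\<^sub>R x"] hom[of t x] t by simp
    then have "t * (2 * c * (((y - X *v \<beta>) v* X) \<bullet> x)) \<le> t * (N x + t * (c * (norm (X *v x))\<^sup>2))"
      by (simp add: algebra_simps)
    then show "2 * c * (((y - X *v \<beta>) v* X) \<bullet> x) \<le> N x + t * (c * (norm (X *v x))\<^sup>2)"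
      using t by simp
  qed
  have "N \<beta> \<le> 2 * c * (((y - X *v \<beta>) v* X) \<bullet> \<beta>)"
  proof (rule le_of_le_add_small)
    fix t :: real assume t: "0 < t" "t < 1"
    \<comment> \<open>Since 1 - t is nonnegative, homogeneity gives the exact penalty of the
      shrunken vector.\<close>
    have "\<beta> + (- t) *\<^sub>R \<beta> = (1 - t) *\<^sub>R \<beta>" by (simp add: scaleR_left_diff_distrib)
    then have "N (\<beta> + (- t) *\<^sub>R \<beta>) = (1 - t) * N \<beta>" using hom[of "1 - t" \<beta>] t by simp
    then have "t * N \<beta> \<le> t * (2 * c * (((y - X *v \<beta>) v* X) \<bullet> \<beta>) + t * (c * (norm (X *v \<beta>))\<^sup>2))"
      using dir[of "- t" \<beta>] by (simp add: algebra_simps)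
    then show "N \<beta> \<le> 2 * c * (((y - X *v \<beta>) v* X) \<bullet> \<beta>) + t * (c * (norm (X *v \<beta>))\<^sup>2)"
      using t by simp
  qed
  with le[of \<beta>] show "2 * c * (((y - X *v \<beta>) v* X) \<bullet> \<beta>) = N \<beta>" by simp
qed

text \<open>By the optimality conditions at \<beta>, the objective at \<beta>' exceeds the minimum
  by at least \<open>c * (norm (X *v (\<beta>' - \<beta>)))\<^sup>2\<close>. Minimality of \<beta>'
  makes this 0.\<close>

lemma penalized_least_squares_unique_fit:
  fixes X :: "real^'p^'n"
  assumes tri: "\<And>x z. N (x + z) \<le> N x + N z"
    and hom: "\<And>t x. 0 \<le> t \<Longrightarrow> N (t *\<^sub>R x) = t * N x"
    and "0 < c"
    and min: "\<And>z. c * (norm (y - X *v \<beta>))\<^sup>2 + N \<beta> \<le> c * (norm (y - X *v z))\<^sup>2 + N z"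
    and min': "\<And>z. c * (norm (y - X *v \<beta>'))\<^sup>2 + N \<beta>' \<le> c * (norm (y - X *v z))\<^sup>2 + N z"
  shows "X *v \<beta> = X *v \<beta>'"
proof -
  note opt = penalized_least_squares_optimality[OF tri hom min]
  have "(norm (y - X *v \<beta>'))\<^sup>2 = (norm (y - X *v \<beta>))\<^sup>2
      - 2 * (((y - X *v \<beta>) v* X) \<bullet> (\<beta>' - \<beta>)) + (norm (X *v (\<beta>' - \<beta>)))\<^sup>2"
    using norm_diff_line[of y X \<beta> 1 "\<beta>' - \<beta>"] by simp
  then have "c * (norm (y - X *v \<beta>'))\<^sup>2 = c * (norm (y - X *v \<beta>))\<^sup>2
      - 2 * c * (((y - X *v \<beta>) v* X) \<bullet> \<beta>') + 2 * c * (((y - X *v \<beta>) v* X) \<bullet> \<beta>)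
      + c * (norm (X *v (\<beta>' - \<beta>)))\<^sup>2"
    by (simp only: inner_diff_right distrib_left right_diff_distrib mult.assoc mult.left_commute)
  then have "c * (norm (X *v (\<beta>' - \<beta>)))\<^sup>2 \<le> 0"
    using min'[of \<beta>] opt(1)[of \<beta>'] opt(2) by linarith
  then have "X *v (\<beta>' - \<beta>) = 0"
    using \<open>0 < c\<close> by (simp add: mult_le_0_iff)
  then show ?thesis by (simp add: matrix_vector_mult_diff_distrib)
qed

text \<open>A sublinear N is convex, hence continuous on the whole finite-dimensional space.
  Coercivity makes the sublevel set through 0 compact, and outside it the objective is larger than
  at 0.\<close>

lemma penalized_least_squares_exists:
  fixes X :: "real^'p^'n"
  assumes tri: "\<And>x z. N (x + z) \<le> N x + N z"
    and hom: "\<And>t x. 0 \<le> t \<Longrightarrow> N (t *\<^sub>R x) = t * N x"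
    and "0 \<le> c" "0 \<le> K" and coercive: "\<And>x. norm x \<le> K * N x"
  shows "\<exists>\<beta>. \<forall>z. c * (norm (y - X *v \<beta>))\<^sup>2 + N \<beta> \<le> c * (norm (y - X *v z))\<^sup>2 + N z"
proof -
  define F where "F z = c * (norm (y - X *v z))\<^sup>2 + N z" for z
  have "convex_on UNIV N"
    by (rule convex_onI) (use tri hom in \<open>auto intro: order_trans[OF tri]\<close>)
  then have "continuous_on UNIV N" by (simp add: convex_on_continuous)
  then have cF: "continuous_on UNIV F"
    unfolding F_def by (intro continuous_intros matrix_vector_mult_linear_continuous_on)
  define S where "S = {z. F z \<le> F 0}"
  have "norm z \<le> K * F 0" if "z \<in> S" for z
  proof -
    have "N z \<le> F 0" using that \<open>0 \<le> c\<close> by (simp add: S_def F_def) (smt (verit) mult_nonneg_nonneg zero_le_power2)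
    then show ?thesis using coercive[of z] \<open>0 \<le> K\<close> by (meson mult_left_mono order_trans)
  qed
  then have "bounded S" by (auto simp: bounded_iff)
  moreover have "closed S"
    unfolding S_def using cF by (intro closed_Collect_le continuous_on_const)
  ultimately have "compact S" by (simp add: compact_eq_bounded_closed)
  moreover have "0 \<in> S" by (simp add: S_def)
  ultimately obtain b where "b \<in> S" "\<forall>z\<in>S. F b \<le> F z"
    using continuous_attains_inf[of S F] cF continuous_on_subset by blast
  then have "F b \<le> F z" for z
    by (cases "z \<in> S") (auto simp: S_def)
  then show ?thesis unfolding F_def by blast
qed

section \<open>The block Lasso\<close>

lemma weight_matrix_inverse:
  fixes X :: "real^'p^'n" and w :: "'j \<Rightarrow> real"
  assumes G: "group_partition G" and w: "\<And>j. w j \<noteq> 0" and k: "k \<in> G j"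
  shows "(X ** matrix_inv (weight_matrix G w)) $ i $ k = X $ i $ k / w j"
proof -
  define h where "h l = (THE j. l \<in> G j)" for l
  define W D :: "real^'p^'p" where "W = weight_matrix G w" and "D = (\<chi> k l. if k = l then 1 / w (h k) else 0)"
  have W: "W = (\<chi> k l. if k = l then w (h k) else 0)"
    unfolding W_def weight_matrix_def h_def ..
  have hk: "h k = j"
    using G k unfolding h_def group_partition_def disjoint_family_on_def
    by (intro the_equality) auto
  have WD: "W ** D = mat 1" and DW: "D ** W = mat 1"
    using w by (auto simp: W D_def matrix_matrix_mult_def mat_def vec_eq_iff if_distrib[of "\<lambda>x. x * _"] cong: if_cong)
  \<comment> \<open>\<open>matrix_inv\<close> is a choice of two-sided inverse, so existence comes
    first; uniqueness then identifies it with D.\<close>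
  have "\<exists>A. W ** A = mat 1 \<and> A ** W = mat 1" using WD DW by blast
  then have "matrix_inv W ** W = mat 1"
    unfolding matrix_inv_def by (metis (mono_tags, lifting) someI_ex)
  then have "matrix_inv W = D"
    using WD by (metis matrix_mul_assoc matrix_mul_lid matrix_mul_rid)
  then have "(X ** matrix_inv W) $ i $ k = X $ i $ k / w (h k)"
    by (simp add: D_def matrix_matrix_mult_def if_distrib[of "\<lambda>x. _ * x"] cong: if_cong)
  then show ?thesis by (simp add: W_def hk)
qed

lemma block_block: "block S (block T v) = block (S \<inter> T) v"
  by (auto simp: block_def vec_eq_iff)

lemma sum_blocks:
  fixes G :: "'j::finite \<Rightarrow> 'p::finite set"
  assumes "group_partition G"
  shows "(\<Sum>j\<in>UNIV. block (G j) v) = v"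
  unfolding vec_eq_iff
proof
  fix k
  obtain j where j: "k \<in> G j" using assms unfolding group_partition_def by blast
  have "(\<Sum>i\<in>UNIV. block (G i) v $ k) = (\<Sum>i\<in>UNIV. if i = j then v $ k else 0)"
    using assms j by (intro sum.cong) (auto simp: block_def group_partition_def disjoint_family_on_def)
  then show "(\<Sum>j\<in>UNIV. block (G j) v) $ k = v $ k" by (simp add: sum_component)
qed

section \<open>The group penalty as a coercive sublinear function\<close>

definition group_penalty :: "real \<Rightarrow> ('j::finite \<Rightarrow> 'p set) \<Rightarrow> ('j \<Rightarrow> real) \<Rightarrow> real \<Rightarrow> real^'p \<Rightarrow> real" where
  "group_penalty \<alpha> G w lam x = lam * (\<Sum>j\<in>UNIV. w j * lp_norm (ereal \<alpha>) (block (G j) x))"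

lemma group_penalty_triangle:
  assumes "1 \<le> \<alpha>" "0 \<le> lam" "\<And>j. 0 \<le> w j"
  shows "group_penalty \<alpha> G w lam (x + z) \<le> group_penalty \<alpha> G w lam x + group_penalty \<alpha> G w lam z"
  unfolding group_penalty_def distrib_left[symmetric] sum.distrib[symmetric]
  using assms by (intro mult_left_mono sum_mono) (simp_all add: block_add lp_norm_triangle)

lemma group_penalty_scaleR:
  assumes "1 \<le> \<alpha>" "0 \<le> t"
  shows "group_penalty \<alpha> G w lam (t *\<^sub>R x) = t * group_penalty \<alpha> G w lam x"
  using assms
  by (simp add: group_penalty_def block_scaleR lp_norm_scaleR sum_distrib_left mult.left_commute)

text \<open>Disjointness leaves one term, so testing optimality on vectors supported in one group
  separates the groups.\<close>

lemma group_penalty_block: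
  fixes G :: "'j::finite \<Rightarrow> 'p::finite set"
  assumes "group_partition G" "0 < \<alpha>"
  shows "group_penalty \<alpha> G w lam (block (G j) x) = lam * w j * lp_norm (ereal \<alpha>) (block (G j) x)"
proof -
  have "w i * lp_norm (ereal \<alpha>) (block (G i) (block (G j) x)) =
      (if i = j then w j * lp_norm (ereal \<alpha>) (block (G j) x) else 0)" for i
  proof (cases "i = j")
    case False
    then have "G i \<inter> G j = {}"
      using assms(1) by (auto simp: group_partition_def disjoint_family_on_def)
    then have "block (G i) (block (G j) x) = 0"
      by (simp add: block_block) (simp add: block_def vec_eq_iff)
    then show ?thesis using False assms(2) by (simp add: lp_norm_eq_0_iff)
  qed (simp add: block_block)
  then show ?thesis by (simp add: group_penalty_def)
qed

lemma group_penalty_coercive: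
  fixes G :: "'j::finite \<Rightarrow> 'p::finite set"
  assumes G: "group_partition G" and "0 < \<alpha>" "0 < lam" and w: "\<And>j. 0 < w j"
  shows "\<exists>K\<ge>0. \<forall>x. norm x \<le> K * group_penalty \<alpha> G w lam x"
proof -
  obtain h where h: "k \<in> G (h k)" for k
    using G unfolding group_partition_def by (metis UNIV_I UN_E)
  \<comment> \<open>Each coordinate is at most its group norm, hence at most the penalty over
    \<open>lam * w (h k)\<close>. The bound of the Euclidean norm by the l1 norm adds these
    constants up.\<close>
  define K where "K = (\<Sum>k\<in>UNIV. 1 / (lam * w (h k)))"
  have comp: "\<bar>x $ k\<bar> \<le> 1 / (lam * w (h k)) * group_penalty \<alpha> G w lam x" for x k
  proof -
    have "\<bar>x $ k\<bar> \<le> lp_norm (ereal \<alpha>) (block (G (h k)) x)"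
      using component_le_lp_norm[OF \<open>0 < \<alpha>\<close>, of "block (G (h k)) x" k] h by (simp add: block_def)
    then have "w (h k) * \<bar>x $ k\<bar> \<le> w (h k) * lp_norm (ereal \<alpha>) (block (G (h k)) x)"
      using w[of "h k"] by simp
    also have "\<dots> \<le> (\<Sum>j\<in>UNIV. w j * lp_norm (ereal \<alpha>) (block (G j) x))"
      using w by (intro member_le_sum) (auto simp: lp_norm_nonneg less_imp_le)
    finally have "lam * (w (h k) * \<bar>x $ k\<bar>) \<le> group_penalty \<alpha> G w lam x"
      using \<open>0 < lam\<close> by (simp add: group_penalty_def)
    then show ?thesis using \<open>0 < lam\<close> w[of "h k"] by (simp add: field_simps)
  qed
  have "norm x \<le> K * group_penalty \<alpha> G w lam x" for x
  proof -
    have "norm x \<le> (\<Sum>k\<in>UNIV. \<bar>x $ k\<bar>)" by (rule norm_le_l1_cart)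
    also have "\<dots> \<le> (\<Sum>k\<in>UNIV. 1 / (lam * w (h k)) * group_penalty \<alpha> G w lam x)"
      by (intro sum_mono comp)
    finally show ?thesis by (simp add: K_def sum_distrib_right)
  qed
  moreover have "0 \<le> K"
    unfolding K_def using \<open>0 < lam\<close> w by (intro sum_nonneg) (simp add: less_imp_le)
  ultimately show ?thesis by blast
qed

lemma block_lasso_solution_iff:
  "block_lasso_solution \<alpha> G w X (y :: real^'n) lam \<beta> \<longleftrightarrow>
    (\<forall>z. 1 / (2 * real CARD('n)) * (norm (y - X *v \<beta>))\<^sup>2 + group_penalty \<alpha> G w lam \<beta>
       \<le> 1 / (2 * real CARD('n)) * (norm (y - X *v z))\<^sup>2 + group_penalty \<alpha> G w lam z)"
  by (simp add: block_lasso_solution_def is_arg_min_def block_lasso_objective_def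
      group_penalty_def not_less)

text \<open>The matrix M = X W^(-1) from the general position assumption.\<close>

definition scaled_design :: "('j \<Rightarrow> 'p set) \<Rightarrow> ('j \<Rightarrow> real) \<Rightarrow> real^'p^'n \<Rightarrow> real^'p^'n" where
  "scaled_design G w X = X ** matrix_inv (weight_matrix G w)"

section \<open>Existence, common fit and stationarity for the block Lasso\<close>

context
  fixes X :: "real^'p^'n"
    and G :: "'j::finite \<Rightarrow> 'p set"
    and w :: "'j \<Rightarrow> real"
    and \<alpha> lam :: real
    and y :: "real^'n"
  assumes \<alpha>: "1 \<le> \<alpha>" and G: "group_partition G" and w_pos: "\<forall>j. 0 < w j"
    and lam: "0 < lam"
begin

lemma weight_pos: "0 < w j" using w_pos by blast

lemma penalty_triangle:
  "group_penalty \<alpha> G w lam (x + z) \<le> group_penalty \<alpha> G w lam x + group_penalty \<alpha> G w lam z"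
  using \<alpha> lam weight_pos by (intro group_penalty_triangle) (auto simp: less_imp_le)

lemma penalty_scaleR: "0 \<le> t \<Longrightarrow> group_penalty \<alpha> G w lam (t *\<^sub>R x) = t * group_penalty \<alpha> G w lam x"
  using \<alpha> by (rule group_penalty_scaleR)

lemma block_lasso_solution_exists: "\<exists>\<beta>. block_lasso_solution \<alpha> G w X y lam \<beta>"
proof -
  obtain K where "0 \<le> K" "\<And>x. norm x \<le> K * group_penalty \<alpha> G w lam x"
    using group_penalty_coercive[of G \<alpha> lam w] \<alpha> G weight_pos lam by auto
  then show ?thesis
    unfolding block_lasso_solution_iff
    by (intro penalized_least_squares_exists penalty_triangle penalty_scaleR) auto
qed

lemma block_lasso_unique_fit:
  assumes "block_lasso_solution \<alpha> G w X y lam \<beta>" "block_lasso_solution \<alpha> G w X y lam \<beta>'"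
  shows "X *v \<beta> = X *v \<beta>'"
  by (rule penalized_least_squares_unique_fit[OF penalty_triangle penalty_scaleR _
        assms[unfolded block_lasso_solution_iff, rule_format]]) simp_all

lemma scaled_design_nth: "k \<in> G j \<Longrightarrow> scaled_design G w X $ i $ k = X $ i $ k / w j"
  unfolding scaled_design_def using G weight_pos by (intro weight_matrix_inverse) (auto simp: less_le)

lemma design_mult_block: "X *v block (G j) x = w j *\<^sub>R (scaled_design G w X *v block (G j) x)"
proof -
  have "X $ i $ k * block (G j) x $ k = w j * (scaled_design G w X $ i $ k * block (G j) x $ k)" for i k
    using weight_pos[of j] by (cases "k \<in> G j") (auto simp: scaled_design_nth block_def)
  then show ?thesis
    unfolding vec_eq_iff matrix_vector_mult_def vector_scaleR_component vec_lambda_beta real_scaleR_def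
      sum_distrib_left
    by (intro allI sum.cong) (rule refl)
qed

lemma design_mult_eq_sum:
  "X *v x = (\<Sum>j\<in>UNIV. w j *\<^sub>R (scaled_design G w X *v block (G j) x))"
proof -
  have "X *v x = X *v (\<Sum>j\<in>UNIV. block (G j) x)" by (simp add: sum_blocks[OF G])
  also have "\<dots> = (\<Sum>j\<in>UNIV. X *v block (G j) x)"
    by (rule linear_sum) simp
  finally show ?thesis by (simp only: design_mult_block)
qed

text \<open>Optimality tested on single groups bounds each s \<bullet> \<open>block (G i) x\<close>
  by the group norm. At \<beta> these bounds add up to an equality, so each is an equality, and
  duality on one block applies.\<close>

lemma block_lasso_stationarity:
  assumes sol: "block_lasso_solution \<alpha> G w X y lam \<beta>"
    and single: "\<alpha> = 1 \<Longrightarrow> card (G j) = 1"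
  defines "s \<equiv> ((1 / (real CARD('n) * lam)) *\<^sub>R (y - X *v \<beta>)) v* scaled_design G w X"
  assumes nz: "block (G j) \<beta> \<noteq> 0"
  shows "lp_norm (conj_exponent \<alpha>) (block (G j) s) = 1 \<and>
    block (G j) \<beta> = lp_norm (ereal \<alpha>) (block (G j) \<beta>) *\<^sub>R eta_vec \<alpha> (block (G j) s)"
proof -
  define c where "c = 1 / (2 * real CARD('n))"
  \<comment> \<open>Here 2c = 1/n, and s carries the factor 1/(n lam); the weight comes from
    \<open>X *v block (G i) x\<close> being w_i times its image under M.\<close>
  have grad: "2 * c * (((y - X *v \<beta>) v* X) \<bullet> block (G i) x) = lam * w i * (s \<bullet> block (G i) x)" for i x
    using lam unfolding dot_lmul_matrix s_def design_mult_block by (simp add: c_def)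
  note opt = penalized_least_squares_optimality[OF penalty_triangle penalty_scaleR
      sol[unfolded block_lasso_solution_iff c_def[symmetric], rule_format]]
  have dual: "s \<bullet> block (G i) x \<le> lp_norm (ereal \<alpha>) (block (G i) x)" for i x
  proof -
    have "lam * w i * (s \<bullet> block (G i) x) \<le> lam * w i * lp_norm (ereal \<alpha>) (block (G i) x)"
      using opt(1)[of "block (G i) x"] \<alpha> by (simp add: grad group_penalty_block[OF G])
    then show ?thesis using lam weight_pos[of i] by (simp add: mult.assoc)
  qed
  have "(\<Sum>i\<in>UNIV. lam * w i * (s \<bullet> block (G i) \<beta>))
      = 2 * c * (((y - X *v \<beta>) v* X) \<bullet> (\<Sum>i\<in>UNIV. block (G i) \<beta>))"
    unfolding inner_sum_right sum_distrib_left grad ..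
  also have "\<dots> = (\<Sum>i\<in>UNIV. lam * w i * lp_norm (ereal \<alpha>) (block (G i) \<beta>))"
    using opt(2) by (simp add: sum_blocks[OF G] group_penalty_def sum_distrib_left mult.assoc)
  finally have "lam * w j * (s \<bullet> block (G j) \<beta>) = lam * w j * lp_norm (ereal \<alpha>) (block (G j) \<beta>)"
    by (rule sum_mono_inv) (use dual lam weight_pos in \<open>auto intro!: mult_left_mono simp: less_imp_le\<close>)
  then have eq: "s \<bullet> block (G j) \<beta> = lp_norm (ereal \<alpha>) (block (G j) \<beta>)"
    using lam weight_pos[of j] by simp
  show ?thesis
  proof (rule dual_pair_block[OF \<alpha> single _ _ nz])
    show "block (G j) s \<bullet> x \<le> lp_norm (ereal \<alpha>) x" for x
      using dual[of j x] lp_norm_block_le[of \<alpha> "G j" x] \<alpha> by (simp add: inner_block)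
    show "block (G j) s \<bullet> block (G j) \<beta> = lp_norm (ereal \<alpha>) (block (G j) \<beta>)"
      using eq by (simp add: inner_block block_block)
  qed
qed

end

theorem theorem2p2:
  fixes X :: "real^'p^'n"
    and G :: "'j::finite \<Rightarrow> 'p set"
    and w :: "'j \<Rightarrow> real"
    and \<alpha> lam :: real
    and y :: "real^'n"
  assumes "1 \<le> \<alpha>"
    and "group_partition G"
    and "\<And>j. 0 < w j"
    and "\<alpha> = 1 \<Longrightarrow> (\<forall>j. card (G j) = 1)"
    and "assumption1 X"
    and "assumption2 \<alpha> G w X"
    and "0 < lam"
  shows "(\<exists>!\<beta>. block_lasso_solution \<alpha> G w X y lam \<beta>) \<and>
         (\<forall>\<beta>. block_lasso_solution \<alpha> G w X y lam \<beta> \<longrightarrow>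
            card {j. block (G j) \<beta> \<noteq> 0} \<le> min CARD('n) CARD('j))"
proof -
  have "\<forall>j. 0 < w j" using assms(3) by blast
  note ctx = assms(1,2) this assms(7)
  let ?sol = "block_lasso_solution \<alpha> G w X y lam"
  obtain b where b: "?sol b"
    using block_lasso_solution_exists[OF ctx] by blast
  define M where "M = scaled_design G w X"
  \<comment> \<open>The residual of the fixed solution b serves every solution, because all
    solutions have the same fit; so s, E and f do not depend on the solution.\<close>
  define u where "u = (1 / (real CARD('n) * lam)) *\<^sub>R (y - X *v b)"
  define s where "s = u v* M"
  define E where "E = {j. lp_norm (conj_exponent \<alpha>) (block (G j) s) = 1}"
  define f where "f j = M *v eta_vec \<alpha> (block (G j) s)" for j
  define c where "c \<beta> j = w j * lp_norm (ereal \<alpha>) (block (G j) \<beta>)" for \<beta> j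
  have struct: "j \<in> E \<and> block (G j) \<beta> = lp_norm (ereal \<alpha>) (block (G j) \<beta>) *\<^sub>R eta_vec \<alpha> (block (G j) s)"
    if "?sol \<beta>" "block (G j) \<beta> \<noteq> 0" for \<beta> j
    using block_lasso_stationarity[OF ctx that(1) _ that(2)] assms(4)
      block_lasso_unique_fit[OF ctx that(1) b]
    by (simp add: E_def s_def u_def M_def)
  \<comment> \<open>s is the transpose of M applied to u, and the columns of the transpose are the
    rows of M.\<close>
  have "s \<in> row_space M"
    using matrix_vector_mult_in_columnspace[of "transpose M" u]
    by (simp add: s_def row_space_def)
  then have gp: "general_position E f"
    using assms(6)
    by (simp add: assumption2_def blockwise_general_position_def E_def f_def[abs_def] M_def
        scaled_design_def)
  have hyp: "u \<bullet> f j = 1" if "j \<in> E" for j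
  proof -
    \<comment> \<open>As \<open>eta \<alpha> 0 = 0\<close>, the vector is supported in group j, so s
      may be replaced by its block in the inner product.\<close>
    have "eta_vec \<alpha> (block (G j) s) = block (G j) (eta_vec \<alpha> (block (G j) s))"
      by (simp add: eta_vec_def block_def eta_def vec_eq_iff)
    then have "s \<bullet> eta_vec \<alpha> (block (G j) s) = block (G j) s \<bullet> eta_vec \<alpha> (block (G j) s)"
      by (metis inner_block)
    also have "\<dots> = 1"
      using that assms(1,4) by (intro inner_block_eta_vec) (auto simp: E_def)
    finally show ?thesis by (simp add: f_def s_def dot_lmul_matrix)
  qed
  \<comment> \<open>Groups outside E have zero blocks by \<open>struct\<close>; on E each block is
    its norm times \<eta>(s), and w_j undoes the scaling in M.\<close>
  have fit: "X *v \<beta> = (\<Sum>j\<in>E. c \<beta> j *\<^sub>R f j)" if sol: "?sol \<beta>" for \<beta>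
  proof -
    have "w j *\<^sub>R (M *v block (G j) \<beta>) = (if j \<in> E then c \<beta> j *\<^sub>R f j else 0)" for j
    proof (cases "block (G j) \<beta> = 0")
      case True
      then show ?thesis using assms(1) by (simp add: c_def lp_norm_eq_0_iff)
    next
      case False
      from struct[OF sol False] have "j \<in> E"
        and eq: "block (G j) \<beta> = lp_norm (ereal \<alpha>) (block (G j) \<beta>) *\<^sub>R eta_vec \<alpha> (block (G j) s)"
        by auto
      have "M *v block (G j) \<beta> = lp_norm (ereal \<alpha>) (block (G j) \<beta>) *\<^sub>R f j"
        unfolding f_def by (subst eq) (rule matrix_vector_mult_scaleR)
      then show ?thesis using \<open>j \<in> E\<close> by (simp add: c_def)
    qed
    then show ?thesis
      unfolding design_mult_eq_sum[OF ctx, of X] M_def[symmetric] by (simp add: sum.If_cases)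
  qed
  have unique: "\<beta> = b" if sol: "?sol \<beta>" for \<beta>
  proof -
    have "block (G j) \<beta> = block (G j) b" for j
    proof (cases "j \<in> E")
      case True
      have fits_eq: "(\<Sum>j\<in>E. c \<beta> j *\<^sub>R f j) = (\<Sum>j\<in>E. c b j *\<^sub>R f j)"
        using fit[OF sol] fit[OF b] block_lasso_unique_fit[OF ctx sol b] by simp
      have "c \<beta> j = c b j"
        by (rule general_position_hyperplane_unique_coeffs[OF gp hyp fits_eq True])
      then have norm_eq: "lp_norm (ereal \<alpha>) (block (G j) \<beta>) = lp_norm (ereal \<alpha>) (block (G j) b)"
        using assms(3)[of j] by (simp add: c_def)
      have zero_norm: "lp_norm (ereal \<alpha>) (block (G j) x) = 0 \<longleftrightarrow> block (G j) x = 0" for x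
        using assms(1) by (simp add: lp_norm_eq_0_iff)
      show ?thesis
      \<comment> \<open>Equal norms make both blocks vanish or neither; if neither, both are the
        same multiple of the same vector.\<close>
      proof (cases "block (G j) b = 0")
        case True
        then show ?thesis
          using norm_eq zero_norm[of \<beta>] zero_norm[of b] by simp
      next
        case False
        then have nz: "block (G j) \<beta> \<noteq> 0"
          using norm_eq zero_norm[of \<beta>] zero_norm[of b] by simp
        have "block (G j) \<beta> = lp_norm (ereal \<alpha>) (block (G j) \<beta>) *\<^sub>R eta_vec \<alpha> (block (G j) s)"
          using struct[OF sol nz] by (rule conjunct2)
        also have "\<dots> = block (G j) b"
          unfolding norm_eq using struct[OF b False, THEN conjunct2] by (rule sym)
        finally show ?thesis .
      qed
    next
      case False
      then have "block (G j) \<beta> = 0" "block (G j) b = 0"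
        using struct[OF sol] struct[OF b] by blast+
      then show ?thesis by simp
    qed
    then have "(\<Sum>j\<in>UNIV. block (G j) \<beta>) = (\<Sum>j\<in>UNIV. block (G j) b)"
      by (intro sum.cong) (rule refl)
    then show ?thesis
      by (simp only: sum_blocks[OF assms(2)])
  qed
  \<comment> \<open>The active groups lie in E, which has at most n elements; the bound by J is the
    size of the index type.\<close>
  have "card {j. block (G j) b \<noteq> 0} \<le> card E"
    using struct[OF b] by (intro card_mono) auto
  also have "\<dots> \<le> CARD('n)"
    by (rule general_position_hyperplane(1)[OF gp hyp])
  finally have "card {j. block (G j) b \<noteq> 0} \<le> min CARD('n) CARD('j)"
    by (simp add: card_mono)
  then show ?thesis using b unique by blast
qed

end
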